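(* Let $q$ be an odd prime power with $q\equiv 1\pmod 3$, let $m=(q-1)/3$, and let $\gamma$ be a generator of the multiplicative group $\mathbf{F}_q^*$. For $k\in\{0,1,\dots,m-1\}$ define $a,b,c\in\mathbf{F}_q^*$ by $$a=\frac{2\gamma^{3k}}{3},\qquad b=\frac{1}{3},\qquad c=\frac{-\gamma^{3k}}{3}.$$ Then the polynomial $$g(x)=ax^{3m-1}+bx^{2m+1}+cx^{2m-1}+bx^{m+1}+cx^{m-1}+bx$$ is a permutation polynomial over $\mathbf{F}_q$, and the permutation of $\mathbf{F}_q$ it induces is an involution with exactly $m+1$ fixed points.
   Context: $\mathbf{F}_q$ denotes the finite field with $q$ elements. A permutation polynomial over $\mathbf{F}_q$ is a polynomial $g\in\mathbf{F}_q[x]$ whose associated map $\mathbf{F}_q\to\mathbf{F}_q$, $x\mapsto g(x)$, is a bijection; it is involutory if $g(g(x))=x$ for all $x\in\mathbf{F}_q$. *)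

theory Defs
  imports "HOL-Library.Cardinality" "HOL-Computational_Algebra.Polynomial"
    "HOL-Number_Theory.Cong" "HOL-Number_Theory.Prime_Powers"
begin

text \<open>The finite field with \<open>q\<close> elements is a type \<open>'a\<close> of class \<open>{field, finite}\<close>
  with \<open>CARD('a) = q\<close>; its multiplicative group is \<open>UNIV - {0}\<close>.\<close>

definition mult_group_generator :: "'a::field \<Rightarrow> bool" where
  "mult_group_generator \<gamma> \<longleftrightarrow> \<gamma> \<noteq> 0 \<and> range (\<lambda>i::int. \<gamma> powi i) = UNIV - {0}"

definition permutation_poly :: "'a::{field,finite} poly \<Rightarrow> bool" where
  "permutation_poly g \<longleftrightarrow> bij (poly g)"

definition involutory_poly :: "'a::{field,finite} poly \<Rightarrow> bool" where
  "involutory_poly g \<longleftrightarrow> (\<forall>x. poly g (poly g x) = x)"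

end

theory Submission imports Defs begin

text \<open>Let \<open>t = \<gamma> ^ (3 * k)\<close>, let \<open>x \<noteq> 0\<close> and put \<open>w = x ^ m\<close>, a cube root of unity. Then
  \<open>3 * x * g(x) = x\<^sup>2 * (1 + w + w\<^sup>2) + t * (2 - w - w\<^sup>2)\<close>, so \<open>g(x) = x\<close> if \<open>w = 1\<close>, and
  \<open>g(x) = t / x\<close> otherwise. As \<open>t ^ m = 1\<close>, the map \<open>x \<mapsto> t / x\<close> inverts \<open>w\<close>, so it is an
  involution of the set where \<open>w \<noteq> 1\<close>; a fixed point there would give \<open>w\<^sup>2 = t ^ m = 1 = w ^ 3\<close>,
  hence \<open>w = 1\<close>. The fixed points are therefore \<open>0\<close> and the \<open>m\<close> roots of \<open>x ^ m = 1\<close>.\<close>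

text \<open>The translation \<open>x + 1\<close> permutes the field, so summing it over all elements
  adds nothing to the sum of the \<open>x\<close>, although it contributes one \<open>1\<close> per
  element.\<close>

lemma of_nat_CARD_eq_0: "of_nat CARD('a) = (0 :: 'a :: {field,finite})"
proof -
  have "(\<Sum>x\<in>UNIV. x + 1) = (\<Sum>x\<in>UNIV. x :: 'a)"
    by (rule sum.reindex_bij_witness[of _ "\<lambda>x. x - 1" "\<lambda>x. x + 1"]) auto
  then show ?thesis
    by (simp add: sum.distrib)
qed

text \<open>If \<open>d\<close> vanished in the field, the field's cardinality
  \<open>1 + d * j\<close> would equal \<open>1\<close> there instead of \<open>0\<close>. The cases
  \<open>d = 2\<close> and \<open>d = 3\<close> give \<open>a \<noteq> 0\<close> and the meaning of
  the denominators \<open>3\<close>.\<close>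

lemma of_nat_neq_0_if_CARD_cong_1:
  assumes "[CARD('a) = 1] (mod d)"
  shows "of_nat d \<noteq> (0 :: 'a :: {field,finite})"
proof
  assume d: "of_nat d = (0 :: 'a)"
  obtain j where "CARD('a) = 1 + d * j"
    using assms cong_le_nat[of 1 "CARD('a)" d] by (auto simp: cong_sym_eq mult.commute Suc_leI)
  then have "of_nat CARD('a) = (1 :: 'a)"
    using d by simp
  then show False
    by (simp add: of_nat_CARD_eq_0)
qed

text \<open>The library's \<open>finite_field_power_card_eq_same\<close> needs the class \<open>finite_field\<close>, which
  \<open>{field,finite}\<close> does not imply.\<close>

lemma power_CARD_minus_1_eq_1:
  fixes x :: "'a :: {field,finite}"
  assumes "x \<noteq> 0"
  shows "x ^ (CARD('a) - 1) = 1"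
proof -
  have "(\<Prod>y\<in>UNIV - {0}. x * y) = (\<Prod>y\<in>UNIV - {0}. y)"
    using assms
    by (intro prod.reindex_bij_witness[of _ "\<lambda>y. y / x" "\<lambda>y. x * y"]) auto
  moreover have "(\<Prod>y\<in>UNIV - {0}. y) \<noteq> (0 :: 'a)"
    by simp
  ultimately show ?thesis
    by (simp add: prod.distrib card_Diff_singleton)
qed

text \<open>The degree bounds the count above. For the lower bound, \<open>X ^ (n * m) - 1\<close>
  is \<open>X ^ m - 1\<close> times a cofactor of degree at most \<open>(n - 1) * m\<close>. All
  \<open>n * m\<close> nonzero elements are roots of the product, and the cofactor accounts for at
  most \<open>(n - 1) * m\<close> of them.\<close>

lemma card_roots_of_unity_finite_field:
  assumes "CARD('a) - 1 = n * m" "0 < m" "0 < n"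
  shows "card {x :: 'a :: {field,finite}. x ^ m = 1} = m"
proof (rule antisym)
  show "card {x :: 'a. x ^ m = 1} \<le> m"
  proof -
    let ?p = "monom 1 m + [:- 1:] :: 'a poly"
    have deg: "degree ?p = m"
      using assms(2) by (subst degree_add_eq_left) (simp_all add: degree_monom_eq)
    then have "?p \<noteq> 0"
      using assms(2) by auto
    from card_poly_roots_bound[OF this] show ?thesis
      by (simp add: deg poly_monom)
  qed
  let ?r = "\<Sum>i<n. monom 1 (i * m) :: 'a poly"
  have r_eval: "poly ?r x = (\<Sum>i<n. (x ^ m) ^ i)" for x
    by (simp add: poly_sum poly_monom power_mult[symmetric] mult.commute)
  have r_deg: "degree ?r \<le> (n - 1) * m"
    by (rule degree_sum_le) (auto intro!: order.trans[OF degree_monom_le] mult_right_mono)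
  \<comment> \<open>The root bound requires \<open>?r\<close> to be nonzero; as
    \<open>0 < m\<close>, only the summand \<open>i = 0\<close> reaches the constant term.\<close>
  have "coeff ?r 0 = (\<Sum>i<n. if i = 0 then 1 else 0)"
    using assms(2) by (simp add: coeff_sum coeff_monom)
  also have "\<dots> = 1"
    using assms(3) by (simp add: sum.delta)
  finally have "?r \<noteq> 0"
    by auto
  then have r_card: "card {x. poly ?r x = 0} \<le> (n - 1) * m"
    using card_poly_roots_bound r_deg order.trans by blast
  have "UNIV - {0} \<subseteq> {x :: 'a. x ^ m = 1} \<union> {x. poly ?r x = 0}"
  proof
    fix x :: 'a
    assume "x \<in> UNIV - {0}"
    then have "(x ^ m) ^ n = 1"
      using power_CARD_minus_1_eq_1[of x] assms(1) by (simp add: power_mult[symmetric] mult.commute)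
    then have "(x ^ m - 1) * poly ?r x = 0"
      by (simp add: r_eval power_diff_1_eq[symmetric])
    then show "x \<in> {x :: 'a. x ^ m = 1} \<union> {x. poly ?r x = 0}"
      by auto
  qed
  then have "card (UNIV - {0 :: 'a}) \<le> card ({x :: 'a. x ^ m = 1} \<union> {x. poly ?r x = 0})"
    by (intro card_mono) auto
  also have "\<dots> \<le> card {x :: 'a. x ^ m = 1} + card {x. poly ?r x = 0}"
    by (rule card_Un_le)
  finally have "n * m \<le> card {x :: 'a. x ^ m = 1} + (n - 1) * m"
    using r_card assms(1) by (simp add: card_Diff_singleton)
  moreover have "n * m = m + (n - 1) * m"
    using assms(3) by (cases n) auto
  ultimately show "m \<le> card {x :: 'a. x ^ m = 1}"
    by linarith
qed

theorem theorem2p4: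
  fixes \<gamma> a b c :: "'a::{field,finite}"
    and q m k :: nat
    and g :: "'a poly"
  assumes "q = CARD('a)"
    and "primepow q"
    and "odd q"
    and "[q = 1] (mod 3)"
    and "m = (q - 1) div 3"
    and "mult_group_generator \<gamma>"
    and "k \<in> {0..<m}"
    and "a = 2 * \<gamma> ^ (3 * k) / 3"
    and "b = 1 / 3"
    and "c = - (\<gamma> ^ (3 * k)) / 3"
    and "g = monom a (3 * m - 1) + monom b (2 * m + 1) + monom c (2 * m - 1)
             + monom b (m + 1) + monom c (m - 1) + monom b 1"
  shows "a \<noteq> 0 \<and> b \<noteq> 0 \<and> c \<noteq> 0 \<and>
         permutation_poly g \<and> involutory_poly g \<and>
         card {x. poly g x = x} = m + 1"
proof -
  define t where "t = \<gamma> ^ (3 * k)"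
  have three: "(3 :: 'a) \<noteq> 0"
    using of_nat_neq_0_if_CARD_cong_1[where 'a='a, of 3] assms(1,4) by simp
  have two: "(2 :: 'a) \<noteq> 0"
    using of_nat_neq_0_if_CARD_cong_1[where 'a='a, of 2] assms(1,3)
    by (simp add: cong_def odd_iff_mod_2_eq_one)
  have card_eq: "CARD('a) - 1 = 3 * m"
    using assms(1,3,4,5) unfolding cong_def by presburger
  have "0 < m"
    using assms(7) by simp
  \<comment> \<open>Parity excludes \<open>m = 1\<close>, for which \<open>x ^ (m - 1)\<close> would
    be a constant term and \<open>g\<close> would not fix \<open>0\<close>.\<close>
  moreover have "even m"
    using card_eq assms(1,3) by presburger
  ultimately have m: "2 \<le> m"
    by presburger
  have cube: "(x ^ m) ^ 3 = 1" if "x \<noteq> 0" for x :: 'a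
    using power_CARD_minus_1_eq_1[OF that] card_eq by (simp add: power_mult[symmetric] mult.commute)
  have "\<gamma> \<noteq> 0"
    using assms(6) by (simp add: mult_group_generator_def)
  \<comment> \<open>\<open>t\<close> is the cube of \<open>\<gamma> ^ k\<close>, so its
    \<open>m\<close>-th power is a power with exponent \<open>3 * m\<close>, the order of the
    multiplicative group.\<close>
  then have t0: "t \<noteq> 0" and tm: "t ^ m = 1"
    using cube[of "\<gamma> ^ k"] by (simp_all add: t_def power_mult[symmetric] mult_ac)
  have g0: "poly g 0 = 0"
    using m unfolding assms(11) by (simp add: poly_monom power_0_left)
  \<comment> \<open>The factor \<open>3\<close> clears the denominators, and the factor
    \<open>x\<close> turns each monomial into \<open>1\<close> or \<open>x\<^sup>2\<close> times a
    power of \<open>x ^ m\<close>.\<close>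
  have xg: "3 * (x * poly g x) =
      x\<^sup>2 * (1 + x ^ m + (x ^ m)\<^sup>2) + t * (2 - x ^ m - (x ^ m)\<^sup>2)" if "x \<noteq> 0" for x
  proof -
    have shift: "x * x ^ (n - 1) = x ^ n" if "0 < n" for n
      using that by (simp add: power_eq_if)
    have "x * poly g x = a * (x * x ^ (3 * m - 1)) + b * (x * x ^ (2 * m + 1))
        + c * (x * x ^ (2 * m - 1)) + b * (x * x ^ (m + 1)) + c * (x * x ^ (m - 1)) + b * x\<^sup>2"
      unfolding assms(11) by (simp add: poly_monom algebra_simps power2_eq_square)
    also have "\<dots> = a * x ^ (3 * m) + b * (x * x ^ (2 * m + 1)) + c * x ^ (2 * m)
        + b * (x * x ^ (m + 1)) + c * x ^ m + b * x\<^sup>2"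
      using m shift[of "3 * m"] shift[of "2 * m"] shift[of m] by simp
    also have "\<dots> = a * (x ^ m) ^ 3 + b * (x\<^sup>2 * (x ^ m)\<^sup>2) + c * (x ^ m)\<^sup>2
        + b * (x\<^sup>2 * x ^ m) + c * x ^ m + b * x\<^sup>2"
      by (simp add: power_mult[symmetric] power_add power2_eq_square mult_ac mult_2_right)
    finally have "3 * (x * poly g x) = (3 * a) * (x ^ m) ^ 3 + (3 * b) * (x\<^sup>2 * (x ^ m)\<^sup>2)
        + (3 * c) * (x ^ m)\<^sup>2 + (3 * b) * (x\<^sup>2 * x ^ m) + (3 * c) * x ^ m + (3 * b) * x\<^sup>2"
      by (simp only: distrib_left mult.assoc)
    moreover have "3 * a = 2 * t" "3 * b = 1" "3 * c = - t"
      using three by (simp_all add: assms(8-10) t_def)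
    ultimately show ?thesis
      using cube[OF that] by (simp only:) (simp add: algebra_simps)
  qed
  have g_fix: "poly g x = x" if "x ^ m = 1" for x
  proof -
    have "x \<noteq> 0"
      using that m by (auto simp: power_0_left)
    from xg[OF this] that have "3 * (x * poly g x) = 3 * (x * x)"
      by (simp add: power2_eq_square)
    then show ?thesis
      using three \<open>x \<noteq> 0\<close> by simp
  qed
  have g_inv: "poly g x = t / x" if "x \<noteq> 0" "x ^ m \<noteq> 1" for x
  proof -
    \<comment> \<open>This product is \<open>(x ^ m) ^ 3 - 1\<close>; the first factor is nonzero
      here.\<close>
    have "(x ^ m - 1) * (1 + x ^ m + (x ^ m)\<^sup>2) = 0"
      using cube[OF that(1)] by (simp add: algebra_simps power2_eq_square power3_eq_cube)
    then have s: "1 + x ^ m + (x ^ m)\<^sup>2 = 0"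
      using that(2) by simp
    moreover have "2 - x ^ m - (x ^ m)\<^sup>2 = 3 - (1 + x ^ m + (x ^ m)\<^sup>2)"
      by simp
    ultimately have "3 * (x * poly g x) = 3 * t"
      using xg[OF that(1)] by simp
    then show ?thesis
      using three that(1) by (simp add: field_simps)
  qed
  have invol: "poly g (poly g x) = x" for x
  proof (cases "x = 0 \<or> x ^ m = 1")
    case True
    then show ?thesis
      using g0 g_fix by auto
  next
    case False
    then have "(t / x) ^ m \<noteq> 1" "t / x \<noteq> 0"
      using t0 tm by (auto simp: power_divide)
    with False show ?thesis
      using g_inv[of x] g_inv[of "t / x"] t0 by simp
  qed
  have "{x. poly g x = x} = insert 0 {x. x ^ m = 1}"
  proof (intro set_eqI iffI)
    fix x
    assume x: "x \<in> {x. poly g x = x}"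
    show "x \<in> insert 0 {x. x ^ m = 1}"
    proof (rule ccontr)
      assume "x \<notin> insert 0 {x. x ^ m = 1}"
      then have nz: "x \<noteq> 0" and w: "x ^ m \<noteq> 1"
        by auto
      then have "t = x\<^sup>2"
        using g_inv[of x] x by (simp add: field_simps power2_eq_square)
      then have "(x ^ m)\<^sup>2 = 1"
        using tm by (simp add: power_mult[symmetric] mult.commute)
      then have "x ^ m = 1"
        using cube[OF nz] by (simp add: power2_eq_square power3_eq_cube)
      with w show False ..
    qed
  qed (auto simp: g0 g_fix)
  \<comment> \<open>Inserting \<open>0\<close> thus raises the cardinality by exactly one.\<close>
  moreover have "(0 :: 'a) \<notin> {x. x ^ m = 1}"
    using m by (simp add: power_0_left)
  ultimately have "card {x. poly g x = x} = m + 1"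
    using card_roots_of_unity_finite_field[OF card_eq \<open>0 < m\<close>] by simp
  moreover have "bij (poly g)"
    by (rule o_bij[of "poly g"]) (auto simp: invol)
  ultimately show ?thesis
    using two three t0 invol
    by (simp add: permutation_poly_def involutory_poly_def assms(8-10) t_def[symmetric])
qed

end
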